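(* Let $k$ be an indeterminate and define $$a(k)=10k^2-8k+8,\qquad b(k)=k(k^2-4k+20),\qquad c(k)=(k+2)(k^2-4).$$ Consider the elliptic curve over the rational function field $\mathbb{Q}(k)$ given by $$E:\ y^2=\big(x+a(k)b(k)\big)\big(x+b(k)c(k)\big)\big(x+a(k)c(k)\big).$$ The torsion subgroup of $E(\mathbb{Q}(k))$ is isomorphic to $\mathbb{Z}/2\mathbb{Z}\times\mathbb{Z}/2\mathbb{Z}$.
   Context: When specializing $k$ to a rational number, the values $k=0,\pm2$ are excluded. *)

theory Defs
  imports "HOL-Computational_Algebra.Polynomial" "HOL-Computational_Algebra.Fraction_Field"
    "HOL-Algebra.Elementary_Groups"
begin

type_synonym qk = "rat poly fract"

definition kvar :: qk where "kvar = Fract [:0, 1:] 1"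

definition aK :: qk where "aK = 10 * kvar^2 - 8 * kvar + 8"
definition bK :: qk where "bK = kvar * (kvar^2 - 4 * kvar + 20)"
definition cK :: qk where "cK = (kvar + 2) * (kvar^2 - 4)"

text \<open>Weierstrass coefficients of y^2 = (x+ab)(x+bc)(x+ac) = x^3 + A x^2 + B x + C.\<close>
definition A2 :: qk where "A2 = aK*bK + bK*cK + aK*cK"
definition A4 :: qk where "A4 = aK*bK*bK*cK + aK*bK*aK*cK + bK*cK*aK*cK"
definition A6 :: qk where "A6 = aK*bK*bK*cK*aK*cK"

text \<open>Points of E over Q(k): None is the point at infinity O, Some (x,y) an affine point.\<close>
type_synonym pt = "(qk \<times> qk) option"

definition on_curve :: "pt \<Rightarrow> bool" where
  "on_curve P = (case P of None \<Rightarrow> True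
     | Some (x, y) \<Rightarrow> y^2 = (x + aK*bK) * (x + bK*cK) * (x + aK*cK))"

definition pt_add :: "pt \<Rightarrow> pt \<Rightarrow> pt" where
  "pt_add P Q = (case P of None \<Rightarrow> Q | Some (x1, y1) \<Rightarrow>
     (case Q of None \<Rightarrow> P | Some (x2, y2) \<Rightarrow>
       (if x1 = x2 \<and> y1 = - y2 then None
        else (let l = (if x1 = x2 then (3*x1^2 + 2*A2*x1 + A4) / (2*y1)
                       else (y2 - y1) / (x2 - x1));
                  x3 = l^2 - A2 - x1 - x2
              in Some (x3, - (y1 + l * (x3 - x1)))))))"

definition E_grp :: "pt monoid" where
  "E_grp = \<lparr>carrier = {P. on_curve P}, monoid.mult = pt_add, one = None\<rparr>"

definition E_tors :: "pt set" where
  "E_tors = {P \<in> carrier E_grp. \<exists>n::nat. n > 0 \<and> P [^]\<^bsub>E_grp\<^esub> n = \<one>\<^bsub>E_grp\<^esub>}"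

end

theory Submission
  imports Defs "HOL-Computational_Algebra.Polynomial_Factorial"
    "HOL-Computational_Algebra.Field_as_Ring"
begin

text \<open>
  Associativity of the chord-tangent law is needed only in the form \<open>(A + P) + P = A + 2P\<close>,
  which implies that doubles of torsion points are torsion.

  At a place of \<open>\<rat>(k)\<close> where \<open>x(R)\<close> has a pole (suitably normalized at infinity) the curve
  degenerates, after rescaling by \<open>R\<close>, to the cusp \<open>Y\<^sup>2 = X\<^sup>3\<close>, so that
  \<open>x(mR) / x(R)\<close> reduces to \<open>1 / m\<^sup>2\<close> and no multiple of \<open>R\<close> vanishes. Hence for torsion \<open>R\<close>
  the coordinate \<open>x(R)\<close> is a polynomial of degree at most 6.

  If moreover \<open>R = 2P\<close>, then \<open>x(R) + ab\<close>, \<open>x(R) + bc\<close>, \<open>x(R) + ac\<close> are squares of polynomials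
  \<open>u\<^sub>1, u\<^sub>2, u\<^sub>3\<close> of degree at most 3, and \<open>(u\<^sub>1 - u\<^sub>2)(u\<^sub>1 + u\<^sub>2) = b(a - c)\<close>,
  \<open>(u\<^sub>1 - u\<^sub>3)(u\<^sub>1 + u\<^sub>3) = a(b - c)\<close>. As \<open>a\<close>, \<open>b - c\<close>, \<open>a - c\<close> are irreducible over \<open>\<rat>\<close>, this
  forces \<open>u\<^sub>1 = \<plusminus>(a + b - c) / 2\<close>, so there is a single candidate for \<open>x(R)\<close> (it is the double of
  the non-torsion point \<open>(0, abc)\<close>). The same applies to \<open>2R\<close>, but \<open>x(2R) \<noteq> x(R)\<close> for this candidate.
\<close>

section \<open>Doubling\<close>

lemma on_curve_Some: "on_curve (Some (x, y)) \<longleftrightarrow> y^2 = x^3 + A2 * x^2 + A4 * x + A6"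
  by (simp add: on_curve_def A2_def A4_def A6_def algebra_simps power2_eq_square power3_eq_cube)

lemma pt_add_None [simp]: "pt_add None Q = Q" "pt_add P None = P"
  by (auto simp: pt_add_def split: option.splits)

lemma pt_add_opposite [simp]: "pt_add (Some (x, y)) (Some (x, - y)) = None"
  "pt_add (Some (x, - y)) (Some (x, y)) = None"
  by (simp_all add: pt_add_def)

lemma pt_add_tangent:
  assumes "q \<noteq> 0" and "l * (2 * q) = 3 * p^2 + 2 * A2 * p + A4" and "d = l^2 - A2 - 2 * p"
  shows "pt_add (Some (p, q)) (Some (p, q)) = Some (d, - (q + l * (d - p)))"
proof -
  have "(3 * p^2 + 2 * A2 * p + A4) / (2 * q) = l" using assms by (simp add: divide_simps)
  then show ?thesis using assms by (simp add: pt_add_def Let_def)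
qed

lemma pt_add_chord:
  assumes "x1 \<noteq> x2" and "l * (x2 - x1) = y2 - y1" and "x3 = l^2 - A2 - x1 - x2"
  shows "pt_add (Some (x1, y1)) (Some (x2, y2)) = Some (x3, - (y1 + l * (x3 - x1)))"
proof -
  have "(y2 - y1) / (x2 - x1) = l" using assms by (simp add: divide_simps)
  then show ?thesis
    using assms(1) by (simp only: pt_add_def Let_def option.case prod.case if_False simp_thms assms(3))
qed

text \<open>Abscissas are measured from \<open>p\<close>: \<open>u\<close>, \<open>d\<close>,
  \<open>w\<close> belong to \<open>A\<close>, \<open>2P\<close> and \<open>A + P\<close>. The cases
  follow the coincidences that decide between chord, tangent and \<open>O\<close>:
  \<open>A = P\<close>, \<open>A = - P\<close>, \<open>A + P = - P\<close>, \<open>A = 2P\<close>,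
  and the generic one. Membership of \<open>A + P\<close> in the curve is proved along, so that the
  result can be iterated over multiples of \<open>P\<close>.\<close>

lemma pt_add_add_same:
  assumes P: "on_curve (Some (p, q))" "q \<noteq> 0" and A: "on_curve A"
  shows "pt_add (pt_add A (Some (p, q))) (Some (p, q)) = pt_add A (pt_add (Some (p, q)) (Some (p, q)))"
    (is "pt_add (pt_add A ?P) ?P = pt_add A (pt_add ?P ?P)")
    and "on_curve (pt_add A (Some (p, q)))"
proof -
  define l where "l = (3 * p^2 + 2 * A2 * p + A4) / (2 * q)"
  define d where "d = l^2 - A2 - 3 * p"
  have l: "l * (2 * q) = 3 * p^2 + 2 * A2 * p + A4" using P by (simp add: l_def)
  have PP: "pt_add ?P ?P = Some (p + d, - (q + l * d))"
    using pt_add_tangent[OF P(2) l, of "p + d"] by (simp add: d_def)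
  have q: "q^2 = p^3 + A2 * p^2 + A4 * p + A6" using P by (simp add: on_curve_Some)
  have onPP: "on_curve (pt_add ?P ?P)"
    unfolding PP on_curve_Some using q l d_def by algebra
  have "pt_add (pt_add A ?P) ?P = pt_add A (pt_add ?P ?P) \<and> on_curve (pt_add A ?P)"
  proof (cases A)
    case None
    then show ?thesis using P by simp
  next
    case (Some a)
    then obtain x y where A': "A = Some (x, y)" by (cases a) auto
    have y: "y^2 = x^3 + A2 * x^2 + A4 * x + A6" using A A' by (simp add: on_curve_Some)
    show ?thesis
    proof (cases "x = p")
      case True
      then have "y^2 = q^2" using y q by simp
      then consider "y = q" | "y = - q" by (auto simp: power2_eq_iff)
      then show ?thesis
      proof cases
        case 1
        have AP: "A = ?P" using 1 True A' by simp
        show ?thesis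
        \<comment> \<open>\<open>d = 0\<close> means \<open>2P = - P\<close>, and both sides are
          \<open>O\<close>. Otherwise both sides use the same chord, entered from its two
          ends.\<close>
        proof (cases "d = 0")
          case True
          then show ?thesis using onPP P(2) by (simp add: AP PP)
        next
          case False
          define m where "m = - (2 * q + l * d) / d"
          have m: "m * d = - (2 * q + l * d)" using False by (simp add: m_def)
          have "pt_add (pt_add ?P ?P) ?P = Some (m^2 - A2 - (p+d) - p,
              - (- (q + l * d) + m * (m^2 - A2 - (p+d) - p - (p+d))))"
            unfolding PP by (rule pt_add_chord) (use False m in \<open>auto simp: algebra_simps\<close>)
          moreover have "pt_add ?P (pt_add ?P ?P) = Some (m^2 - A2 - p - (p+d),
              - (q + m * (m^2 - A2 - p - (p+d) - p)))"
            unfolding PP by (rule pt_add_chord) (use False m in \<open>auto simp: algebra_simps\<close>)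
          moreover have "- (- (q + l * d) + m * (m^2 - A2 - (p+d) - p - (p+d)))
              = - (q + m * (m^2 - A2 - p - (p+d) - p))"
            using m by algebra
          ultimately show ?thesis using onPP by (simp add: AP algebra_simps)
        qed
      next
        case 2
        have AP: "A = Some (p, - q)" using 2 True A' by simp
        \<comment> \<open>The mirror image of the tangent at \<open>P\<close> has slope
          \<open>- l\<close>, touches the curve at \<open>- P\<close> and meets it again at
          \<open>2P\<close>. Added along this line, \<open>- P\<close> and \<open>2P\<close> give
          \<open>P\<close>; for \<open>d = 0\<close> the two points coincide and the line is used as
          a tangent.\<close>
        have "pt_add A (pt_add ?P ?P) = ?P"
        proof (cases "d = 0")
          case True
          have "pt_add (Some (p, - q)) (Some (p, - q)) = Some (p + d, - (- q + - l * d))"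
            by (subst pt_add_tangent[where l = "- l" and d = "p + d"]) (use P l in \<open>auto simp: d_def\<close>)
          then show ?thesis using True by (simp add: AP PP)
        next
          case False
          have "pt_add (Some (p, - q)) (Some (p + d, - (q + l * d))) = Some (p, - (- q + - l * (p - p)))"
            by (rule pt_add_chord) (use False in \<open>auto simp: algebra_simps d_def\<close>)
          then show ?thesis by (simp add: AP PP)
        qed
        then show ?thesis by (simp add: AP on_curve_def)
      qed
    next
      case False
      define u where "u = x - p"
      define m where "m = (y - q) / u"
      define w where "w = m^2 - l^2 + d - u"
      have u0: "u \<noteq> 0" using False by (simp add: u_def)
      have m: "m * u = y - q" using u0 by (simp add: m_def)
      \<comment> \<open>This is the difference of the curve equations at \<open>A\<close> and
        \<open>P\<close>, with the derivative of the cubic at \<open>p\<close> replaced by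
        \<open>2 * l * q\<close> and \<open>3 * p + A2\<close> by \<open>l^2 - d\<close>.\<close>
      have "u * ((m - l) * (2 * q + (m + l) * u) - u * (u - d)) = 0"
        using m l q y d_def u_def by algebra
      then have e: "(m - l) * (2 * q + (m + l) * u) = u * (u - d)" using u0 by simp
      have "pt_add A ?P = Some (p + w, - (y + m * (p + w - x)))"
        unfolding A' by (rule pt_add_chord) (use False m in \<open>auto simp: algebra_simps u_def w_def d_def\<close>)
      moreover have "y + m * (p + w - x) = q + m * w" using m u_def by algebra
      ultimately have AP: "pt_add A ?P = Some (p + w, - (q + m * w))" by simp
      have "on_curve (pt_add A ?P)"
        unfolding AP on_curve_Some using e l q d_def w_def by algebra
      moreover have "pt_add (pt_add A ?P) ?P = pt_add A (pt_add ?P ?P)"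
      proof (cases "w = 0")
        case True
        \<comment> \<open>If \<open>A + P\<close> has abscissa \<open>p\<close>, the chord is the
          tangent at \<open>P\<close>. Then \<open>A = - 2P\<close>, and both sides are
          \<open>O\<close>.\<close>
        have "(m - l) * (2 * q) = 0" using e True w_def by algebra
        then have "m = l" using P by simp
        then have "u = d" using True by (simp add: w_def)
        then have "x = p + d" "y = q + l * d" using m u_def \<open>m = l\<close> by (auto simp: algebra_simps)
        then show ?thesis unfolding AP PP unfolding A' by (simp add: True pt_add_def)
      next
        case w0: False
        define m' where "m' = (- 2 * q - m * w) / w"
        define X where "X = m'^2 - A2 - 2 * p - w"
        have m': "m' * w = - 2 * q - m * w" using w0 by (simp add: m'_def)
        have "pt_add (Some (p + w, - (q + m * w))) ?P = Some (X, - (- (q + m * w) + m' * (X - (p + w))))"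
          by (rule pt_add_chord) (use w0 m' in \<open>auto simp: algebra_simps X_def\<close>)
        moreover have "- (q + m * w) + m' * (X - (p + w)) = q + m' * (X - p)"
          using m' by algebra
        ultimately have L: "pt_add (pt_add A ?P) ?P = Some (X, - (q + m' * (X - p)))"
          by (simp add: AP)
        show ?thesis
        proof (cases "u = d")
          case True
          \<comment> \<open>\<open>A\<close> has the abscissa of \<open>2P\<close>. As
            \<open>m \<noteq> l\<close>, relation \<open>e\<close> leaves only
            \<open>A = 2P\<close>, so the right-hand side is a doubling, whose slope
            \<open>n\<close> turns out to be \<open>m' + m - l\<close>.\<close>
          have d0: "d \<noteq> 0" using True u0 by simp
          have ml: "m \<noteq> l" using True w0 by (auto simp: w_def)
          have 1: "2 * q + (m + l) * d = 0" using e True ml by auto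
          have x': "x = p + d" using True by (simp add: u_def)
          moreover have "y = - (q + l * d)" using m 1 True by algebra
          ultimately have APP: "pt_add ?P ?P = A" unfolding PP A' by simp
          have y0: "y \<noteq> 0"
          proof
            assume "y = 0"
            then have "(m - l) * d = 0" using m 1 True by algebra
            then show False using ml d0 by simp
          qed
          define n where "n = (3 * x^2 + 2 * A2 * x + A4) / (2 * y)"
          have n: "n * (2 * y) = 3 * x^2 + 2 * A2 * x + A4" using y0 by (simp add: n_def)
          define X' where "X' = n^2 - A2 - 2 * x"
          have R: "pt_add A A = Some (X', - (y + n * (X' - x)))"
            unfolding A' by (rule pt_add_tangent) (use y0 n X'_def in auto)
          have y': "2 * y = (m - l) * d" using m 1 True by algebra
          have "d * ((n + l) * (m - l) - d) = 0" using n y' x' d_def 1 l by algebra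
          then have n': "(n + l) * (m - l) = d" using d0 by simp
          have "w = (m - l) * (m + l)" by (simp add: w_def True algebra_simps power2_eq_square)
          then have "m + l \<noteq> 0" using w0 by auto
          moreover have "(m + l) * ((m' + m) * (m - l) - d) = 0"
            using m' 1 \<open>w = (m - l) * (m + l)\<close> by algebra
          ultimately have mm: "(m' + m) * (m - l) = d" by simp
          then have "m' + m = n + l" using n' ml by (metis mult_right_cancel right_minus_eq)
          then have nm: "n = m' + m - l" by (simp add: algebra_simps)
          have w': "w = m^2 - l^2" by (simp add: w_def True)
          have XX: "X = X'"
            unfolding X_def X'_def x' nm mm[symmetric] w' by algebra
          have "X - p = m'^2 + d - m^2" using d_def by (simp add: X_def w')
          moreover have "y = q + m * d" using m True by simp
          ultimately have "q + m' * (X - p) = y + n * (X - p - d)"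
            using mm nm by algebra
          then have "q + m' * (X - p) = y + n * (X - x)" by (simp add: x' diff_diff_eq)
          then show ?thesis unfolding L APP R by (simp add: XX)
        next
          case ud: False
          define n where "n = (2 * q + m * u + l * d) / (u - d)"
          have n: "n * (u - d) = 2 * q + m * u + l * d" using ud by (simp add: n_def)
          define X' where "X' = n^2 - A2 - x - (p + d)"
          have "pt_add A (pt_add ?P ?P) = Some (X', - (y + n * (X' - x)))"
            unfolding PP unfolding A'
            by (rule pt_add_chord) (use ud n m in \<open>auto simp: algebra_simps X'_def u_def\<close>)
          \<comment> \<open>\<open>w\<close> and \<open>u - d\<close> are the denominators of the
            slopes \<open>m'\<close> and \<open>n\<close>; once they are cleared, equality of the
            coordinates is a polynomial consequence of \<open>e\<close> and the definitions.\<close>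
          moreover have "w^2 * (u - d)^2 * (X - X') = 0"
            using n m' e w_def X_def X'_def u_def d_def by algebra
          then have XX: "X = X'" using w0 ud by simp
          moreover have "w^3 * (u - d) * ((q + m' * (X - p)) - (y + n * (X' - x))) = 0"
            using n m' e w_def X_def XX u_def d_def m by algebra
          then have "q + m' * (X - p) = y + n * (X' - x)" using w0 ud by simp
          ultimately show ?thesis unfolding L by simp
        qed
      qed
      ultimately show ?thesis by simp
    qed
  qed
  then show "pt_add (pt_add A ?P) ?P = pt_add A (pt_add ?P ?P)" "on_curve (pt_add A ?P)" by auto
qed

section \<open>Multiples of a non-integral point\<close>

locale valuation_ring =
  fixes V :: "'a::field_char_0 set"
  assumes add_closed: "x \<in> V \<Longrightarrow> y \<in> V \<Longrightarrow> x + y \<in> V"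
    and mult_closed: "x \<in> V \<Longrightarrow> y \<in> V \<Longrightarrow> x * y \<in> V"
    and of_rat_closed: "of_rat r \<in> V"
    and inverse_closed: "x \<notin> V \<Longrightarrow> inverse x \<in> V"
begin

definition maxideal :: "'a set" where
  "maxideal = {x \<in> V. x = 0 \<or> inverse x \<notin> V}"

lemma power_closed: "x \<in> V \<Longrightarrow> x ^ n \<in> V"
  using of_rat_closed[of 1] by (induction n) (auto intro: mult_closed)

lemma zero_maxideal: "0 \<in> maxideal"
  using of_rat_closed[of 0] by (simp add: maxideal_def)

lemma maxideal_mult:
  assumes "x \<in> maxideal" "y \<in> V"
  shows "x * y \<in> maxideal"
proof (cases "x * y = 0")
  case False
  have "inverse (x * y) \<notin> V"
  proof
    assume "inverse (x * y) \<in> V"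
    then have "y * inverse (x * y) \<in> V" using assms mult_closed by blast
    moreover have "y * inverse (x * y) = inverse x" using False by (simp add: field_simps)
    ultimately have "inverse x \<in> V" by (simp only:)
    then show False using assms False by (simp add: maxideal_def)
  qed
  then show ?thesis using assms by (auto simp: maxideal_def intro: mult_closed)
qed (use zero_maxideal in auto)

text \<open>One of \<open>x / y\<close> and \<open>y / x\<close> lies in \<open>V\<close>, so the
  sum is one summand times an element of \<open>V\<close>.\<close>

lemma maxideal_add:
  assumes "x \<in> maxideal" "y \<in> maxideal"
  shows "x + y \<in> maxideal"
proof -
  have *: "a + b \<in> maxideal" if "b \<in> maxideal" "b \<noteq> 0" "a / b \<in> V" for a b
  proof -
    have "b * (1 + a / b) \<in> maxideal"
      using that of_rat_closed[of 1] by (intro maxideal_mult add_closed) auto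
    then show ?thesis using that by (simp add: algebra_simps)
  qed
  show ?thesis
  proof (cases "x = 0 \<or> y = 0")
    case False
    have "x / y \<in> V \<or> y / x \<in> V" using inverse_closed[of "x / y"] by auto
    then show ?thesis using *[of x y] *[of y x] assms False by (auto simp: add.commute)
  qed (use assms in auto)
qed

lemma inverse_in_maxideal: "x \<notin> V \<Longrightarrow> inverse x \<in> maxideal"
  using inverse_closed by (auto simp: maxideal_def)

lemma square_closedD: "x ^ 2 \<in> V \<Longrightarrow> x \<in> V"
proof (rule ccontr)
  assume "x ^ 2 \<in> V" "x \<notin> V"
  then have "x ^ 2 * inverse x \<in> V" by (intro mult_closed inverse_closed)
  moreover have "x ^ 2 * inverse x = x" by (simp add: power2_eq_square field_simps)
  ultimately show False using \<open>x \<notin> V\<close> by simp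
qed

text \<open>Reduction modulo the maximal ideal, as a relation: the residue field may be larger than
  \<rat>, and only elements with rational residue get a value.\<close>

definition res :: "'a \<Rightarrow> rat \<Rightarrow> bool" where
  "res x r \<longleftrightarrow> x - of_rat r \<in> maxideal"

lemma res_of_rat: "res (of_rat r) r"
  by (simp add: res_def zero_maxideal)

lemma res_closed: "res x r \<Longrightarrow> x \<in> V"
  using add_closed[of "x - of_rat r" "of_rat r"] of_rat_closed[of r]
  by (auto simp: res_def maxideal_def)

lemma res_add: "res x r \<Longrightarrow> res y s \<Longrightarrow> res (x + y) (r + s)"
  using maxideal_add[of "x - of_rat r" "y - of_rat s"]
  by (simp add: res_def of_rat_add algebra_simps)

lemma res_mult:
  assumes "res x r" "res y s"
  shows "res (x * y) (r * s)"
proof -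
  have "(y - of_rat s) * x + (x - of_rat r) * of_rat s \<in> maxideal"
    using assms res_closed of_rat_closed by (intro maxideal_add maxideal_mult) (auto simp: res_def)
  then show ?thesis by (simp add: res_def of_rat_mult algebra_simps)
qed

lemma res_diff: "res x r \<Longrightarrow> res y s \<Longrightarrow> res (x - y) (r - s)"
  using res_add[of x r "- y" "- s"] res_mult[OF res_of_rat[of "-1"], of y s] by simp

lemma res_unique:
  assumes "res x r" "res x s"
  shows "r = s"
proof (rule ccontr)
  assume "r \<noteq> s"
  have "res (x - x) (r - s)" using assms by (rule res_diff)
  then have "of_rat (s - r) \<in> maxideal" by (simp add: res_def of_rat_diff)
  moreover have "inverse (of_rat (s - r)) \<in> V"
    using of_rat_closed[of "inverse (s - r)"] by (simp add: of_rat_inverse)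
  ultimately show False using \<open>r \<noteq> s\<close> by (simp add: maxideal_def)
qed

lemma res_inverse:
  assumes "res x r" "r \<noteq> 0"
  shows "res (inverse x) (inverse r)"
proof -
  have notM: "x \<notin> maxideal"
    using assms res_unique[of x r 0] by (auto simp: res_def)
  then have x0: "x \<noteq> 0" and x: "inverse x \<in> V"
    using assms res_closed zero_maxideal by (auto simp: maxideal_def)
  have "(x - of_rat r) * (inverse x * of_rat (- inverse r)) \<in> maxideal"
    using assms x of_rat_closed by (intro maxideal_mult mult_closed) (auto simp: res_def)
  moreover have "(x - of_rat r) * (inverse x * of_rat (- inverse r)) = inverse x - of_rat (inverse r)"
    using x0 assms(2) by (simp add: of_rat_minus of_rat_inverse) (simp add: field_simps)
  ultimately show ?thesis by (simp add: res_def)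
qed

lemma res_divide: "res x r \<Longrightarrow> res y s \<Longrightarrow> s \<noteq> 0 \<Longrightarrow> res (x / y) (r / s)"
  using res_mult[OF _ res_inverse] by (simp add: divide_inverse)

end

section \<open>Reduction of multiples to the cusp\<close>

lemma E_grp_simps [simp]:
  "carrier E_grp = {P. on_curve P}" "P \<otimes>\<^bsub>E_grp\<^esub> Q = pt_add P Q" "\<one>\<^bsub>E_grp\<^esub> = None"
  by (simp_all add: E_grp_def)

text \<open>The scale \<open>w\<close> carries the weights 1, 2, 3 of the coefficients and will be
  \<open>1\<close> at finite places and \<open>k^6\<close> at infinity. Since \<open>w / x1\<close>
  reduces to 0, so do the coefficients rescaled by powers of \<open>x1\<close>. The induction shows
  that each multiple is affine with nonzero reduced coordinates.\<close>

lemma formal_multiples: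
  fixes V :: "qk set"
  assumes "valuation_ring V" and R: "on_curve (Some (x1, y1))" and w: "w \<noteq> 0"
    and coeffs: "A2 / w \<in> V" "A4 / w^2 \<in> V" "A6 / w^3 \<in> V" and x1: "x1 / w \<notin> V" and "n > 0"
  shows "Some (x1, y1) [^]\<^bsub>E_grp\<^esub> (n::nat) \<noteq> None"
proof -
  interpret valuation_ring V by fact
  let ?R = "Some (x1, y1)"
  have M: "w / x1 \<in> maxideal" using inverse_in_maxideal[OF x1] by simp
  then have wx: "w / x1 \<in> V" by (simp add: maxideal_def)
  have x0: "x1 \<noteq> 0" using x1 of_rat_closed[of 0] by auto
  have "w / x1 * (A2 / w) \<in> maxideal" "w / x1 * (w / x1 * (A4 / w^2)) \<in> maxideal"
    "w / x1 * ((w / x1)^2 * (A6 / w^3)) \<in> maxideal"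
    by (intro maxideal_mult mult_closed power_closed M wx coeffs)+
  then have a2: "res (A2 / x1) 0" and a4: "res (A4 / x1^2) 0" and a6: "res (A6 / x1^3) 0"
    using w x0 by (simp_all add: res_def power2_eq_square power3_eq_cube mult.assoc)
  have one: "res 1 1" using res_of_rat[of 1] by simp
  \<comment> \<open>In the coordinates \<open>X = x / x1\<close>, \<open>Y = y / y1\<close> the
    curve is \<open>g * Y^2 = X^3 + (A2 / x1) * X^2 + ...\<close>; \<open>g\<close> reduces to 1 and
    the lower coefficients to 0.\<close>
  define g where "g = y1^2 / x1^3"
  have "g = 1 + A2 / x1 + A4 / x1^2 + A6 / x1^3"
    using R x0 by (simp add: g_def on_curve_Some power2_eq_square power3_eq_cube field_simps)
  then have g: "res g 1"
    using res_add[OF res_add[OF res_add[OF res_of_rat[of 1] a2] a4] a6] by simp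
  have y0: "y1 \<noteq> 0" using g res_unique[of 0 1 0] res_of_rat[of 0] by (auto simp: g_def)
  \<comment> \<open>The smooth points \<open>(1 / t^2, 1 / t^3)\<close> of the cusp add like their
    parameters \<open>t\<close>, and \<open>R\<close> has \<open>t = 1\<close>. The count starts at
    \<open>Suc 0\<close> because the zeroth multiple is \<open>O\<close>.\<close>
  have "\<exists>x y. ?R [^]\<^bsub>E_grp\<^esub> Suc k = Some (x, y) \<and>
      res (x / x1) (1 / of_nat (Suc k)^2) \<and> res (y / y1) (1 / of_nat (Suc k)^3)" for k
  proof (induction k)
    case 0
    then show ?case using x0 y0 res_of_rat[of 1] by simp
  next
    case (Suc k)
    define m :: rat where "m = of_nat (Suc k)"
    have m1: "m \<ge> 1" by (simp add: m_def)
    have m': "of_nat (Suc (Suc k)) = m + 1" by (simp add: m_def)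
    from Suc obtain x y where xy: "?R [^]\<^bsub>E_grp\<^esub> Suc k = Some (x, y)"
      "res (x / x1) (1 / m^2)" "res (y / y1) (1 / m^3)" unfolding m_def by blast
    \<comment> \<open>\<open>L\<close> is the slope of the line through the points, measured in units of \<open>y1 / x1\<close>.\<close>
    obtain L where L: "res L ((1 + m + m^2) / (m * (m + 1)))"
      and S: "?R [^]\<^bsub>E_grp\<^esub> Suc (Suc k) =
        Some ((y1 / x1 * L)^2 - A2 - x - x1,
          - (y + y1 / x1 * L * ((y1 / x1 * L)^2 - A2 - x - x1 - x)))"
    \<comment> \<open>Only the first addition is a doubling; its tangent slope \<open>3 / 2\<close>
      is the value of the chord formula at \<open>m = 1\<close>. Afterwards the residue
      \<open>1 / m^2\<close> differs from 1, so the abscissas differ and the chord applies.\<close>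
    proof (cases k)
      case 0
      have xy1: "x = x1" "y = y1" using xy(1) 0 by auto
      define L where "L = (3 + 2 * (A2 / x1) + A4 / x1^2) / (2 * g)"
      have "res L ((3 + 2 * 0 + 0) / (2 * 1))"
        unfolding L_def using res_of_rat[of 3] res_of_rat[of 2] a2 a4 g
        by (intro res_divide res_add res_mult) auto
      moreover have "y1 / x1 * L * (2 * y1) = 3 * x1^2 + 2 * A2 * x1 + A4"
        using x0 y0 by (simp add: L_def g_def field_simps power2_eq_square power3_eq_cube)
      then have "pt_add ?R ?R = Some ((y1 / x1 * L)^2 - A2 - x1 - x1,
          - (y1 + y1 / x1 * L * ((y1 / x1 * L)^2 - A2 - x1 - x1 - x1)))"
        by (intro pt_add_tangent y0) auto
      ultimately show ?thesis using that[of L] 0 xy1 by (simp add: m_def)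
    next
      case (Suc j)
      have m2: "m > 1" by (simp add: m_def Suc)
      define L where "L = (y / y1 - 1) / (x / x1 - 1)"
      have ne: "1 / m^2 - 1 \<noteq> 0"
        using m2 by (simp add: field_simps power2_eq_1_iff)
      have "x \<noteq> x1"
        using xy(2) res_unique[of "x / x1" "1 / m^2" 1] res_of_rat[of 1] ne x0 by auto
      have "res L ((1 / m^3 - 1) / (1 / m^2 - 1))"
        unfolding L_def
        by (rule res_divide[OF res_diff[OF xy(3) one] res_diff[OF xy(2) one] ne])
      also have "(1 / m^3 - 1) / (1 / m^2 - 1) = (1 + m + m^2) / (m * (m + 1))"
      proof -
        have "m * (m + 1) \<noteq> 0" using m1 by auto
        moreover have "(1 / m^3 - 1) * (m * (m + 1)) = (1 + m + m^2) * (1 / m^2 - 1)"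
          using m1 by (simp add: field_simps power2_eq_square power3_eq_cube)
        ultimately show ?thesis using ne frac_eq_eq by blast
      qed
      finally have resL: "res L ((1 + m + m^2) / (m * (m + 1)))" .
      have "x / x1 - 1 \<noteq> 0" using \<open>x \<noteq> x1\<close> x0 by simp
      then have "L * (x / x1 - 1) = y / y1 - 1" by (simp add: L_def)
      then have "y1 / x1 * L * (x1 - x) = y1 - y"
        using x0 y0 by (simp add: field_simps)
      then have "pt_add (Some (x, y)) ?R = Some ((y1 / x1 * L)^2 - A2 - x - x1,
          - (y + y1 / x1 * L * ((y1 / x1 * L)^2 - A2 - x - x1 - x)))"
        by (intro pt_add_chord \<open>x \<noteq> x1\<close>) auto
      then show ?thesis using that[of L] resL xy(1) by simp
    qed
    define X where "X = (y1 / x1 * L)^2 - A2 - x - x1"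
    have "X / x1 = g * L^2 - A2 / x1 - x / x1 - 1"
      using x0 by (simp add: X_def g_def field_simps power2_eq_square power3_eq_cube)
    moreover have "res (g * L^2 - A2 / x1 - x / x1 - 1)
        (1 * ((1 + m + m^2) / (m * (m + 1)) * ((1 + m + m^2) / (m * (m + 1)))) - 0 - 1 / m^2 - 1)"
      unfolding power2_eq_square[of L] using res_of_rat[of 1] g a2 xy(2) L
      by (intro res_diff res_mult) auto
    moreover have "1 * ((1 + m + m^2) / (m * (m + 1)) * ((1 + m + m^2) / (m * (m + 1)))) - 0 - 1 / m^2 - 1
        = 1 / (m + 1)^2"
    proof -
      have "m \<noteq> 0" "m + 1 \<noteq> 0" using m1 by auto
      then show ?thesis by (simp add: divide_simps) algebra
    qed
    ultimately have resX: "res (X / x1) (1 / (m + 1)^2)" by simp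
    have "- (y + y1 / x1 * L * (X - x)) / y1 = L * (x / x1 - X / x1) - y / y1"
      using x0 y0 by (simp add: field_simps)
    moreover have "res (L * (x / x1 - X / x1) - y / y1)
        ((1 + m + m^2) / (m * (m + 1)) * (1 / m^2 - 1 / (m + 1)^2) - 1 / m^3)"
      using L xy resX by (intro res_diff res_mult) auto
    moreover have "(1 + m + m^2) / (m * (m + 1)) * (1 / m^2 - 1 / (m + 1)^2) - 1 / m^3 = 1 / (m + 1)^3"
    proof -
      have "m \<noteq> 0" "m + 1 \<noteq> 0" using m1 by auto
      then show ?thesis by (simp add: divide_simps) algebra
    qed
    ultimately have "res (- (y + y1 / x1 * L * (X - x)) / y1) (1 / (m + 1)^3)" by simp
    then show ?case using S resX unfolding X_def m' by blast
  qed
  from this[of "n - 1"] show ?thesis using \<open>n > 0\<close> by auto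
qed

section \<open>Doubles of torsion points\<close>

lemma nat_pow_on_curve:
  assumes "on_curve (Some (p, q))" "q \<noteq> 0"
  shows "on_curve (Some (p, q) [^]\<^bsub>E_grp\<^esub> (n::nat))"
  by (induction n) (use assms pt_add_add_same(2) in \<open>auto simp: on_curve_def[of None]\<close>)

text \<open>Powers in a monoid record add \<open>P\<close> on the right one copy at a time, so the
  induction step is exactly \<open>(A + P) + P = A + 2P\<close> with \<open>A\<close> the
  \<open>2n\<close>-th multiple.\<close>

lemma nat_pow_double:
  assumes "on_curve (Some (p, q))" "q \<noteq> 0"
  shows "Some (p, q) [^]\<^bsub>E_grp\<^esub> (2 * n) =
    pt_add (Some (p, q)) (Some (p, q)) [^]\<^bsub>E_grp\<^esub> (n::nat)"
proof (induction n)
  case (Suc n)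
  have "2 * Suc n = Suc (Suc (2 * n))" by simp
  then show ?case
    using Suc pt_add_add_same(1)[OF assms nat_pow_on_curve[OF assms, of "2 * n"]] by simp
qed simp

lemma nat_pow_periodic:
  "P [^]\<^bsub>E_grp\<^esub> (n::nat) = None \<Longrightarrow> P [^]\<^bsub>E_grp\<^esub> (n + j) = P [^]\<^bsub>E_grp\<^esub> j"
  by (induction j) auto

text \<open>The \<open>n\<close>-th multiple of \<open>2P\<close> is the \<open>2n\<close>-th
  multiple of \<open>P\<close>, and counting starts afresh after \<open>n\<close>.\<close>

lemma torsion_double:
  assumes "on_curve (Some (p, q))" "q \<noteq> 0" "Some (p, q) [^]\<^bsub>E_grp\<^esub> (n::nat) = None"
  shows "pt_add (Some (p, q)) (Some (p, q)) [^]\<^bsub>E_grp\<^esub> n = None"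
  using nat_pow_double[OF assms(1,2), of n] nat_pow_periodic[OF assms(3), of n] assms(3)
  by (simp add: mult_2)

section \<open>Places of the rational function field\<close>

lemma to_fract_numeral [simp]: "to_fract (numeral n) = numeral n"
  by (induction n) (simp_all only: numeral.simps to_fract_add to_fract_1)

lemma to_fract_power [simp]: "to_fract (x ^ n) = to_fract x ^ n"
  by (induction n) simp_all

lemma to_fract_of_int [simp]: "to_fract (of_int n) = of_int n"
  by (induction n rule: int_induct[where k = 0]) simp_all

lemma of_rat_qk: "(of_rat r :: qk) = to_fract [:r:]"
proof (cases r)
  case (Fract a b)
  have "to_fract [:r:] * of_int b = to_fract ([:r:] * of_int b)"
    by (simp only: to_fract_mult to_fract_of_int)
  also have "[:r:] * of_int b = of_int a"
    using Fract by (simp add: of_int_poly Fract_of_int_quotient)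
  finally have "to_fract [:r:] * of_int b = of_int a" by simp
  then show ?thesis using Fract by (simp add: of_rat_rat field_simps)
qed

section \<open>Finite places and the place at infinity\<close>

definition place_at :: "rat poly \<Rightarrow> qk set" where
  "place_at \<pi> = {to_fract n / to_fract d |n d. \<not> \<pi> dvd d}"

definition place_infinity :: "qk set" where
  "place_infinity = {to_fract n / to_fract d |n d. d \<noteq> 0 \<and> degree n \<le> degree d}"

lemma qk_coprime_cases:
  obtains n d where "(x::qk) = to_fract n / to_fract d" "coprime n d" "d \<noteq> 0"
  by (metis Fract_conv_to_fract Fract_quot_of_fract coprime_quot_of_fract snd_quot_of_fract_nonzero)

lemma to_fract_in_place_at: "prime_elem \<pi> \<Longrightarrow> to_fract n \<in> place_at \<pi>"
  unfolding place_at_def by (rule CollectI, rule exI[of _ n], rule exI[of _ 1]) (auto simp: prime_elem_def)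

lemma valuation_ring_place_at:
  assumes "prime_elem \<pi>"
  shows "valuation_ring (place_at \<pi>)"
proof
  fix x y assume "x \<in> place_at \<pi>" "y \<in> place_at \<pi>"
  then obtain n d n' d' where *: "x = to_fract n / to_fract d" "\<not> \<pi> dvd d"
    "y = to_fract n' / to_fract d'" "\<not> \<pi> dvd d'" unfolding place_at_def by blast
  then have d: "\<not> \<pi> dvd d * d'" "d \<noteq> 0" "d' \<noteq> 0" using assms by (auto simp: prime_elem_dvd_mult_iff)
  have "x + y = to_fract (n * d' + n' * d) / to_fract (d * d')"
    using * d by (simp add: field_simps)
  then show "x + y \<in> place_at \<pi>" using d unfolding place_at_def by blast
  have "x * y = to_fract (n * n') / to_fract (d * d')" using * by simp
  then show "x * y \<in> place_at \<pi>" using d unfolding place_at_def by blast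
next
  fix r show "of_rat r \<in> place_at \<pi>" using to_fract_in_place_at[OF assms] by (simp add: of_rat_qk)
next
  fix x assume x: "x \<notin> place_at \<pi>"
  obtain n d where *: "x = to_fract n / to_fract d" "coprime n d" "d \<noteq> 0" by (rule qk_coprime_cases)
  then have "\<pi> dvd d" using x unfolding place_at_def by blast
  then have "\<not> \<pi> dvd n"
    using * assms not_coprimeI[of \<pi> n d] by (auto simp: prime_elem_def)
  moreover have "inverse x = to_fract d / to_fract n" using * by simp
  ultimately show "inverse x \<in> place_at \<pi>" unfolding place_at_def by blast
qed

lemma degree_add_le_mult:
  fixes n d n' d' :: "rat poly"
  assumes "degree n \<le> degree d" "degree n' \<le> degree d'" "d \<noteq> 0" "d' \<noteq> 0"
  shows "degree (n * d' + n' * d) \<le> degree (d * d')"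
proof (rule degree_add_le)
  show "degree (n * d') \<le> degree (d * d')" "degree (n' * d) \<le> degree (d * d')"
    using assms degree_mult_le[of n d'] degree_mult_le[of n' d] by (auto simp: degree_mult_eq)
qed

lemma valuation_ring_place_infinity: "valuation_ring place_infinity"
proof
  fix x y assume "x \<in> place_infinity" "y \<in> place_infinity"
  then obtain n d n' d' where *: "x = to_fract n / to_fract d" "degree n \<le> degree d"
    "y = to_fract n' / to_fract d'" "degree n' \<le> degree d'" and d: "d \<noteq> 0" "d' \<noteq> 0"
    unfolding place_infinity_def by blast
  have "x + y = to_fract (n * d' + n' * d) / to_fract (d * d')"
    using * d by (simp add: field_simps)
  then show "x + y \<in> place_infinity"
    using d degree_add_le_mult[OF *(2,4) d] unfolding place_infinity_def
    by (metis (mono_tags, lifting) mem_Collect_eq no_zero_divisors)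
  have "x * y = to_fract (n * n') / to_fract (d * d')" using * by simp
  moreover have "degree (n * n') \<le> degree (d * d')"
    using * d degree_mult_le[of n n'] by (simp add: degree_mult_eq)
  ultimately show "x * y \<in> place_infinity" using d unfolding place_infinity_def
    by (metis (mono_tags, lifting) mem_Collect_eq no_zero_divisors)
next
  fix r
  have "(of_rat r :: qk) = to_fract [:r:] / to_fract 1" by (simp add: of_rat_qk)
  moreover have "(1 :: rat poly) \<noteq> 0 \<and> degree [:r:] \<le> degree (1 :: rat poly)" by simp
  ultimately show "of_rat r \<in> place_infinity" unfolding place_infinity_def by blast
next
  fix x assume x: "x \<notin> place_infinity"
  obtain n d where *: "x = to_fract n / to_fract d" "d \<noteq> 0" by (rule qk_coprime_cases)
  then have deg: "degree n > degree d" using x unfolding place_infinity_def by force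
  then have "n \<noteq> 0 \<and> degree d \<le> degree n" by auto
  moreover have "inverse x = to_fract d / to_fract n" using * by simp
  ultimately show "inverse x \<in> place_infinity" unfolding place_infinity_def by blast
qed

text \<open>A prime factor of the reduced denominator would be a pole, so the denominator is a
  unit.\<close>

lemma to_fract_if_in_all_places:
  assumes "\<And>\<pi>. prime_elem \<pi> \<Longrightarrow> x \<in> place_at \<pi>"
  obtains p where "x = to_fract p"
proof -
  obtain n d where *: "x = to_fract n / to_fract d" "coprime n d" "d \<noteq> 0" by (rule qk_coprime_cases)
  have "is_unit d"
  proof (rule ccontr)
    assume "\<not> is_unit d"
    then obtain \<pi> where \<pi>: "prime_elem \<pi>" "\<pi> dvd d"
      using prime_divisor_exists[of d] * by (auto simp: prime_def)
    then obtain n' d' where 2: "x = to_fract n' / to_fract d'" "\<not> \<pi> dvd d'"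
      using assms[OF \<pi>(1)] unfolding place_at_def by blast
    then have "d' \<noteq> 0" by auto
    then have "to_fract (n * d') = to_fract (n' * d)" using 2 * by (simp add: field_simps)
    then have "n * d' = n' * d" by (simp only: to_fract_eq_iff)
    then have "\<pi> dvd n * d'" using \<pi> by simp
    then have "\<pi> dvd n" using \<pi> 2 by (simp add: prime_elem_dvd_mult_iff)
    then show False using \<pi> * not_coprimeI[of \<pi> n d] by (auto simp: prime_elem_def)
  qed
  then obtain e where "1 = d * e" by (rule dvdE)
  then have "to_fract d * to_fract e = 1" by (metis to_fract_1 to_fract_mult)
  moreover have "x * to_fract d = to_fract n" using * by simp
  ultimately have "x = to_fract (n * e)" by (metis mult.assoc mult.right_neutral to_fract_mult)
  then show thesis by (rule that)
qed

lemma to_fract_div_in_place_infinity: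
  assumes "v \<noteq> 0"
  shows "to_fract p / to_fract v \<in> place_infinity \<longleftrightarrow> degree p \<le> degree v"
proof
  assume "to_fract p / to_fract v \<in> place_infinity"
  then obtain n d where *: "to_fract p / to_fract v = to_fract n / to_fract d" "d \<noteq> 0" "degree n \<le> degree d"
    unfolding place_infinity_def by blast
  then have "to_fract (p * d) = to_fract (n * v)" using assms by (simp add: field_simps)
  then have "p * d = n * v" by (simp only: to_fract_eq_iff)
  then have "degree (p * d) \<le> degree n + degree v" by (simp add: degree_mult_le)
  then show "degree p \<le> degree v" using * by (cases "p = 0") (auto simp: degree_mult_eq)
next
  assume "degree p \<le> degree v"
  then show "to_fract p / to_fract v \<in> place_infinity" using assms unfolding place_infinity_def by blast
qed

section \<open>Factorizations over the rationals\<close>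

definition aP :: "rat poly" where "aP = [:8, -8, 10:]"
definition bP :: "rat poly" where "bP = [:0, 20, -4, 1:]"
definition cP :: "rat poly" where "cP = [:-8, -4, 2, 1:]"

lemma abc_to_fract: "aK = to_fract aP" "bK = to_fract bP" "cK = to_fract cP"
proof -
  have k: "kvar = to_fract [:0, 1:]" by (simp add: kvar_def to_fract_def)
  have a: "aP = 10 * [:0, 1:]^2 - 8 * [:0, 1:] + 8"
    by (simp add: aP_def power2_eq_square numeral_poly)
  show "aK = to_fract aP"
    unfolding a aK_def k
    by (simp only: to_fract_add to_fract_diff to_fract_mult to_fract_power to_fract_numeral)
  have b: "bP = [:0, 1:] * ([:0, 1:]^2 - 4 * [:0, 1:] + 20)"
    by (simp add: bP_def power2_eq_square numeral_poly)
  show "bK = to_fract bP"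
    unfolding b bK_def k
    by (simp only: to_fract_add to_fract_diff to_fract_mult to_fract_power to_fract_numeral)
  have c: "cP = ([:0, 1:] + 2) * ([:0, 1:]^2 - 4)"
    by (simp add: cP_def power2_eq_square numeral_poly)
  show "cK = to_fract cP"
    unfolding c cK_def k
    by (simp only: to_fract_add to_fract_diff to_fract_mult to_fract_power to_fract_numeral)
qed

lemma degree_abc: "degree aP = 2" "degree bP = 3" "degree cP = 3" "aP \<noteq> 0" "bP \<noteq> 0" "cP \<noteq> 0"
  by (simp_all add: aP_def bP_def cP_def)

section \<open>Irreducibility of \<open>a\<close>, \<open>b - c\<close> and
  \<open>a - c\<close>\<close>

text \<open>In these degrees a proper factorization contains a linear factor, hence a root.\<close>

lemma irreducible_degree_2_3:
  fixes p :: "'a::field poly"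
  assumes "degree p = 2 \<or> degree p = 3" and no_root: "\<And>r. poly p r \<noteq> 0"
  shows "irreducible p"
proof (rule irreducibleI)
  show "p \<noteq> 0" using assms by auto
  then show "\<not> is_unit p" using assms(1) by (auto simp: is_unit_iff_degree)
  fix f g assume p: "p = f * g"
  have *: False if "degree h = 1" "h dvd p" for h
  proof -
    obtain e c where h: "h = [:c, e:]" "e \<noteq> 0" using \<open>degree h = 1\<close> by (rule degree1_coeffs)
    then have "poly h (- c / e) = 0" by simp
    then show False using no_root[of "- c / e"] that(2) by auto
  qed
  have "f \<noteq> 0" "g \<noteq> 0" using p assms by auto
  then have "degree f + degree g = 2 \<or> degree f + degree g = 3"
    using assms(1) by (simp add: p degree_mult_eq)
  moreover have "degree f \<noteq> 1" "degree g \<noteq> 1" using *[of f] *[of g] p by auto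
  ultimately have "degree f = 0 \<or> degree g = 0" by linarith
  then show "is_unit f \<or> is_unit g" using \<open>f \<noteq> 0\<close> \<open>g \<noteq> 0\<close> by (auto simp: is_unit_iff_degree)
qed

lemma prime_a: "prime_elem aP"
proof (rule field_poly_irreducible_imp_prime, rule irreducible_degree_2_3)
  fix r :: rat
  have "poly aP r = 2 * r^2 + 8 * (r - 1/2)^2 + 6"
    by (simp add: aP_def algebra_simps power2_eq_square)
  also have "\<dots> > 0" by (intro add_nonneg_pos add_nonneg_nonneg) auto
  finally show "poly aP r \<noteq> 0" by simp
qed (simp add: aP_def)

lemma rat_coprime_cases:
  fixes r :: rat
  obtains m n :: int where "r = of_int m / of_int n" "n > 0" "coprime m n"
  using quotient_of_div[of r] quotient_of_denom_pos[of r] quotient_of_coprime[of r]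
  by (cases "quotient_of r") blast

text \<open>Here \<open>b - c = - 2 * (3 * k^2 - 12 * k - 4)\<close>, whose second factor reversed
  is Eisenstein at 3: for a root \<open>m / n\<close>, the prime 3 divides \<open>n\<close> and then
  \<open>m\<close>.\<close>

lemma prime_b_minus_c: "prime_elem (bP - cP)"
proof (rule field_poly_irreducible_imp_prime, rule irreducible_degree_2_3)
  fix r :: rat
  show "poly (bP - cP) r \<noteq> 0"
  proof
    assume *: "poly (bP - cP) r = 0"
    obtain m n :: int where mn: "r = of_int m / of_int n" "n > 0" "coprime m n" by (rule rat_coprime_cases)
    have "3 * (of_int m :: rat)^2 - 12 * of_int m * of_int n - 4 * of_int n ^2 = 0"
      using * mn by (simp add: bP_def cP_def field_simps power2_eq_square)
    then have "(of_int (3 * m^2 - 12 * m * n - 4 * n^2) :: rat) = 0" by simp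
    then have e: "3 * m^2 - 12 * m * n - 4 * n^2 = 0" by (simp only: of_int_eq_0_iff)
    then have "4 * n^2 = 3 * (m^2 - 4 * m * n)" by (simp add: algebra_simps)
    then have "3 dvd 4 * n^2" by (metis dvd_triv_left)
    then have "3 dvd n^2" by (simp add: prime_dvd_mult_iff)
    then have "3 dvd n" by (rule prime_dvd_power_int[rotated]) simp
    then obtain j where j: "n = 3 * j" by (rule dvdE)
    have "m^2 = 3 * (4 * m * j + 4 * j^2)" using e j by algebra
    then have "3 dvd m^2" by (metis dvd_triv_left)
    then have "3 dvd m" by (rule prime_dvd_power_int[rotated]) simp
    then show False using \<open>3 dvd n\<close> mn(3) not_coprimeI[of 3 m n] by auto
  qed
qed (simp add: bP_def cP_def)

text \<open>Up to sign the cubic is monic, so a rational root is an integer.\<close>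

lemma prime_a_minus_c: "prime_elem (aP - cP)"
proof (rule field_poly_irreducible_imp_prime, rule irreducible_degree_2_3)
  fix r :: rat
  show "poly (aP - cP) r \<noteq> 0"
  proof
    assume *: "poly (aP - cP) r = 0"
    obtain m n :: int where mn: "r = of_int m / of_int n" "n > 0" "coprime m n" by (rule rat_coprime_cases)
    have "(of_int m :: rat)^3 - of_int n * (8 * of_int m^2 - 4 * of_int m * of_int n + 16 * of_int n ^2) = 0"
      using * mn by (simp add: aP_def cP_def field_simps power2_eq_square power3_eq_cube)
    then have "(of_int (m^3 - n * (8 * m^2 - 4 * m * n + 16 * n^2)) :: rat) = 0" by simp
    then have e: "m^3 = n * (8 * m^2 - 4 * m * n + 16 * n^2)"
      by (simp only: of_int_eq_0_iff right_minus_eq)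
    then have "n dvd m^3" by simp
    moreover have "coprime n (m^3)" using mn(3) by (simp add: coprime_commute)
    ultimately have "is_unit n" by (metis coprime_common_divisor dvd_refl)
    then have "n = 1" using mn by simp
    \<comment> \<open>In this form the sign is evident for \<open>m \<ge> 8\<close> and for
      \<open>m < 4\<close>; four integers remain to be tried.\<close>
    then have e: "m^2 * (m - 8) + 4 * (m - 4) = 0"
      using e by (simp add: algebra_simps power2_eq_square power3_eq_cube)
    consider "m \<ge> 8" | "m < 4" | "m = 4" | "m = 5" | "m = 6" | "m = 7" by linarith
    then show False
    proof cases
      case 1
      then have "m^2 * (m - 8) + 4 * (m - 4) > 0" by (intro add_nonneg_pos) auto
      then show False using e by simp
    next
      case 2
      then have "m^2 * (m - 8) + 4 * (m - 4) < 0"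
        by (intro add_nonpos_neg mult_nonneg_nonpos) auto
      then show False using e by simp
    qed (use e in auto)
  qed
qed (simp add: aP_def cP_def)

section \<open>Comparing two factorizations\<close>

lemma smult_cofactor:
  fixes A B g :: "'a::field poly"
  assumes "A \<noteq> 0" "smult s A * g = A * B" "s \<noteq> 0"
  shows "g = smult (1 / s) B"
proof -
  have "A * smult s g = A * B" using assms(2) by simp
  then have "smult s g = B" using assms(1) by (metis mult_left_cancel)
  then show ?thesis using assms(3) by auto
qed

text \<open>\<open>A\<close> divides \<open>f\<close> or \<open>g\<close>, with constant cofactor
  \<open>s\<close> by the degree hypothesis; the other factor is then \<open>B / s\<close>. Taking
  the sum hides which of the two it was.\<close>

lemma prime_factor_sum:
  fixes A B f g :: "'a::field poly"
  assumes A: "prime_elem A" and fg: "f * g = A * B" and B: "B \<noteq> 0"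
    and deg: "\<And>h. f = A * h \<or> g = A * h \<Longrightarrow> degree h = 0"
  shows "\<exists>s. s \<noteq> 0 \<and> f + g = smult s A + smult (1 / s) B"
proof -
  have A0: "A \<noteq> 0" using A by auto
  have *: "\<exists>s. s \<noteq> 0 \<and> f' + g' = smult s A + smult (1 / s) B"
    if f': "f' = A * h" "f' * g' = A * B" and h: "degree h = 0" for f' g' h
  proof -
    obtain s where s: "h = [:s:]" using h by (rule degree_eq_zeroE)
    then have "s \<noteq> 0" using f' B A0 by auto
    moreover have "f' = smult s A" using f'(1) s by simp
    ultimately show ?thesis using smult_cofactor[OF A0, of s g' B] f'(2) by auto
  qed
  have "A dvd f \<or> A dvd g" using A fg by (metis dvd_triv_left prime_elem_dvd_mult_iff)
  then show ?thesis
    using *[of f _ g] *[of g _ f] fg deg by (auto simp: mult.commute add.commute)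
qed

lemma difference_of_squares_unique:
  fixes u1 u2 u3 :: "rat poly"
  assumes deg: "degree u1 \<le> 3" "degree u2 \<le> 3" "degree u3 \<le> 3"
    and 12: "u1^2 - u2^2 = bP * (aP - cP)" and 13: "u1^2 - u3^2 = aP * (bP - cP)"
  shows "4 * u1^2 = (aP + bP - cP)^2"
proof -
  have bc: "degree (bP - cP) = 2" "bP - cP \<noteq> 0" and ac: "degree (aP - cP) = 3" "aP - cP \<noteq> 0"
    by (simp_all add: aP_def bP_def cP_def)
  have fg: "(u1 - u3) * (u1 + u3) = aP * (bP - cP)"
    using 13 by (simp add: algebra_simps power2_eq_square)
  have "\<exists>s. s \<noteq> 0 \<and> (u1 - u3) + (u1 + u3) = smult s aP + smult (1 / s) (bP - cP)"
  proof (rule prime_factor_sum[OF prime_a fg bc(2)])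
    fix h assume h: "u1 - u3 = aP * h \<or> u1 + u3 = aP * h"
    \<comment> \<open>The degree bound leaves room for a linear \<open>h\<close>. Since
      \<open>b - c\<close> is a prime of degree 2 it must divide \<open>g\<close>, which makes
      \<open>h\<close> constant.\<close>
    have *: "degree h = 0" if "f = aP * h" "f * g = aP * (bP - cP)" "degree f \<le> 3" for f g
    proof -
      have "aP * (h * g) = aP * (bP - cP)" using that by (simp add: mult.assoc)
      then have hg: "h * g = bP - cP" using degree_abc by (metis mult_left_cancel)
      then have "h \<noteq> 0" using bc by auto
      then have "degree h \<le> 1" using that degree_abc by (simp add: degree_mult_eq)
      then have "\<not> bP - cP dvd h" using bc \<open>h \<noteq> 0\<close> by (auto dest: dvd_imp_degree_le)
      then have "bP - cP dvd g" using prime_b_minus_c hg by (metis dvd_refl prime_elem_dvd_mult_iff)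
      then have "2 \<le> degree g" using bc hg by (metis dvd_imp_degree_le mult_zero_right)
      moreover have "degree h + degree g = 2"
        using bc hg by (metis degree_mult_eq mult_zero_left mult_zero_right)
      ultimately show "degree h = 0" by linarith
    qed
    have "degree (u1 - u3) \<le> 3" "degree (u1 + u3) \<le> 3"
      using deg by (auto intro: degree_diff_le degree_add_le)
    then show "degree h = 0" using h *[of "u1 - u3" "u1 + u3"] *[of "u1 + u3" "u1 - u3"] fg
      by (auto simp: mult.commute)
  qed
  then obtain s where s: "s \<noteq> 0" "2 * u1 = smult s aP + smult (1 / s) (bP - cP)" by auto
  have fg: "(u1 - u2) * (u1 + u2) = (aP - cP) * bP"
    using 12 by (simp add: algebra_simps power2_eq_square)
  have "\<exists>t. t \<noteq> 0 \<and> (u1 - u2) + (u1 + u2) = smult t (aP - cP) + smult (1 / t) bP"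
  proof (rule prime_factor_sum[OF prime_a_minus_c fg degree_abc(5)])
    \<comment> \<open>Now the prime factor \<open>a - c\<close> already has the maximal degree
      3.\<close>
    fix h assume h: "u1 - u2 = (aP - cP) * h \<or> u1 + u2 = (aP - cP) * h"
    have "degree (u1 - u2) \<le> 3" "degree (u1 + u2) \<le> 3"
      using deg by (auto intro: degree_diff_le degree_add_le)
    then have "degree ((aP - cP) * h) \<le> 3" using h by auto
    then show "degree h = 0" using ac by (cases "h = 0") (auto simp: degree_mult_eq)
  qed
  then obtain t where t: "t \<noteq> 0" "2 * u1 = smult t (aP - cP) + smult (1 / t) bP" by auto
  have eq: "smult s aP + smult (1 / s) (bP - cP) = smult t (aP - cP) + smult (1 / t) bP"
    using s t by simp
  \<comment> \<open>The left side of \<open>eq\<close> has degree at most 2, while the coefficient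
    of \<open>k^3\<close> on the right is \<open>1 / t - t\<close>.\<close>
  have "1 / t = t" using arg_cong[OF eq, of "\<lambda>p. coeff p 3"]
    by (simp add: aP_def bP_def cP_def numeral_eq_Suc)
  then have "2 * u1 = smult t (aP + bP - cP)" using t by (simp add: smult_add_right smult_diff_right)
  then have "(2 * u1)^2 = smult (t^2) ((aP + bP - cP)^2)" by (simp add: smult_power)
  moreover have "t^2 = 1" using t(1) \<open>1 / t = t\<close> by (simp add: field_simps power2_eq_square)
  ultimately show ?thesis by (simp add: power_mult_distrib)
qed

section \<open>Torsion points\<close>

text \<open>The coefficients are the elementary symmetric functions of \<open>ab\<close>,
  \<open>bc\<close>, \<open>ac\<close>, whose degrees are at most 6; this fixes \<open>k^6\<close>
  as the scale at infinity.\<close>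

lemma coeffs_to_fract:
  obtains p2 p4 p6 where "A2 = to_fract p2" "A4 = to_fract p4" "A6 = to_fract p6"
    "degree p2 \<le> 6" "degree p4 \<le> 12" "degree p6 \<le> 18"
proof
  show "A2 = to_fract (aP * bP + bP * cP + aP * cP)" by (simp add: A2_def abc_to_fract)
  show "A4 = to_fract (aP * bP * bP * cP + aP * bP * aP * cP + bP * cP * aP * cP)"
    by (simp add: A4_def abc_to_fract)
  show "A6 = to_fract (aP * bP * bP * cP * aP * cP)" by (simp add: A6_def abc_to_fract)
qed (auto intro!: degree_add_le simp: degree_mult_eq degree_abc)

lemma torsion_x_integral:
  assumes "on_curve (Some (x, y))" "n > 0" "Some (x, y) [^]\<^bsub>E_grp\<^esub> (n::nat) = None"
  shows "prime_elem \<pi> \<Longrightarrow> x \<in> place_at \<pi>"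
    and "x / to_fract ([:0, 1:]^6) \<in> place_infinity"
proof -
  obtain p2 p4 p6 where c: "A2 = to_fract p2" "A4 = to_fract p4" "A6 = to_fract p6"
    "degree p2 \<le> 6" "degree p4 \<le> 12" "degree p6 \<le> 18" by (rule coeffs_to_fract)
  show "x \<in> place_at \<pi>" if "prime_elem \<pi>"
    using formal_multiples[OF valuation_ring_place_at[OF that] assms(1), of 1 n] assms(2,3)
    by (auto simp: c to_fract_in_place_at[OF that])
  define w :: "rat poly" where "w = [:0, 1:]^6"
  have w: "w \<noteq> 0" "degree w = 6" by (auto simp: w_def degree_power_eq)
  have "A2 / to_fract w \<in> place_infinity" "A4 / to_fract w ^ 2 \<in> place_infinity"
    "A6 / to_fract w ^ 3 \<in> place_infinity"
    unfolding c to_fract_power[symmetric]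
    by (subst to_fract_div_in_place_infinity; use w c in \<open>simp add: degree_power_eq\<close>)+
  then show "x / to_fract ([:0, 1:]^6) \<in> place_infinity"
    using formal_multiples[OF valuation_ring_place_infinity assms(1), of "to_fract w" n] assms(2,3) w(1)
    unfolding w_def[symmetric] by auto
qed

text \<open>With \<open>l\<close> the slope of the tangent at \<open>P = (p, q)\<close> and \<open>x = x(2P)\<close>: the number \<open>x(2P) - e\<close>
  is a square for each root \<open>e = - \<alpha>\<close> of the cubic.\<close>

lemma double_x_shift_square:
  fixes p q l x \<alpha> \<beta> \<gamma> :: "'a::field"
  assumes "q^2 = (p + \<alpha>) * (p + \<beta>) * (p + \<gamma>)"
    and "l * (2 * q) = 3 * p^2 + 2 * (\<alpha> + \<beta> + \<gamma>) * p + (\<alpha> * \<beta> + \<beta> * \<gamma> + \<alpha> * \<gamma>)"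
    and "x = l^2 - (\<alpha> + \<beta> + \<gamma>) - 2 * p"
  shows "(x + \<alpha>) * (2 * q)^2 = ((p + \<alpha>)^2 - (\<alpha> - \<beta>) * (\<alpha> - \<gamma>))^2"
proof -
  have "(x + \<alpha>) * (2 * q)^2 = (l * (2 * q))^2 - 4 * (\<beta> + \<gamma> + 2 * p) * q^2"
    unfolding assms(3) by (simp add: algebra_simps power2_eq_square)
  also have "\<dots> = ((p + \<alpha>)^2 - (\<alpha> - \<beta>) * (\<alpha> - \<gamma>))^2"
    unfolding assms(1,2) by algebra
  finally show ?thesis .
qed

text \<open>Valuation rings contain the square roots of their elements: \<open>U\<close> has no
  finite pole because \<open>x + e\<close> has none, and the bound 6 at infinity is halved to
  3.\<close>

lemma torsion_root_polynomial:
  assumes R: "on_curve (Some (x, y))" "n > 0" "Some (x, y) [^]\<^bsub>E_grp\<^esub> (n::nat) = None"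
    and sq: "x + to_fract e = U^2" and e: "degree e \<le> 6"
  obtains u where "U = to_fract u" "degree u \<le> 3"
proof -
  have fin: "U \<in> place_at \<pi>" if "prime_elem \<pi>" for \<pi>
  proof -
    interpret valuation_ring "place_at \<pi>" using that by (rule valuation_ring_place_at)
    show ?thesis
      using square_closedD[of U] add_closed torsion_x_integral(1)[OF R that] to_fract_in_place_at[OF that]
      by (simp add: sq[symmetric])
  qed
  obtain u where u: "U = to_fract u" using to_fract_if_in_all_places[OF fin] .
  interpret valuation_ring place_infinity by (rule valuation_ring_place_infinity)
  have k: "([:0, 1:]^6 :: rat poly) \<noteq> 0" "degree ([:0, 1:]^6 :: rat poly) = 6"
    "([:0, 1:]^3 :: rat poly) \<noteq> 0" "degree ([:0, 1:]^3 :: rat poly) = 3"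
    by (auto simp: degree_power_eq)
  have "to_fract e / to_fract ([:0, 1:]^6) \<in> place_infinity"
    using e k by (subst to_fract_div_in_place_infinity) auto
  then have "x / to_fract ([:0, 1:]^6) + to_fract e / to_fract ([:0, 1:]^6) \<in> place_infinity"
    using torsion_x_integral(2)[OF R] by (rule add_closed[rotated])
  also have "x / to_fract ([:0, 1:]^6) + to_fract e / to_fract ([:0, 1:]^6) = (U / to_fract ([:0, 1:]^3))^2"
    by (simp add: add_divide_distrib[symmetric] sq power_divide)
  finally have "U / to_fract ([:0, 1:]^3) \<in> place_infinity" by (rule square_closedD)
  then have "degree u \<le> 3" using to_fract_div_in_place_infinity[OF k(3), of u] k(4) u by simp
  then show thesis using that u by blast
qed

lemma double_coords:
  assumes "on_curve (Some (p, q))" "q \<noteq> 0"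
  obtains x y where "pt_add (Some (p, q)) (Some (p, q)) = Some (x, y)"
    "(x + aK * bK) * (2 * q)^2 = ((p + aK * bK)^2 - (aK * bK - bK * cK) * (aK * bK - aK * cK))^2"
    "(x + bK * cK) * (2 * q)^2 = ((p + bK * cK)^2 - (bK * cK - aK * bK) * (bK * cK - aK * cK))^2"
    "(x + aK * cK) * (2 * q)^2 = ((p + aK * cK)^2 - (aK * cK - aK * bK) * (aK * cK - bK * cK))^2"
proof -
  define l where "l = (3 * p^2 + 2 * A2 * p + A4) / (2 * q)"
  define x where "x = l^2 - A2 - 2 * p"
  have l: "l * (2 * q) = 3 * p^2 + 2 * A2 * p + A4" using assms by (simp add: l_def)
  have q: "q^2 = (p + aK * bK) * (p + bK * cK) * (p + aK * cK)" using assms by (simp add: on_curve_def)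
  show thesis
  proof (rule that[OF pt_add_tangent[OF assms(2) l x_def]])
    show "(x + aK * bK) * (2 * q)^2 = ((p + aK * bK)^2 - (aK * bK - bK * cK) * (aK * bK - aK * cK))^2"
      by (rule double_x_shift_square) (use q l x_def in \<open>simp_all add: A2_def A4_def algebra_simps\<close>)
    show "(x + bK * cK) * (2 * q)^2 = ((p + bK * cK)^2 - (bK * cK - aK * bK) * (bK * cK - aK * cK))^2"
      by (rule double_x_shift_square) (use q l x_def in \<open>simp_all add: A2_def A4_def algebra_simps\<close>)
    show "(x + aK * cK) * (2 * q)^2 = ((p + aK * cK)^2 - (aK * cK - aK * bK) * (aK * cK - bK * cK))^2"
      by (rule double_x_shift_square) (use q l x_def in \<open>simp_all add: A2_def A4_def algebra_simps\<close>)
  qed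
qed

text \<open>The right-hand side does not mention \<open>P\<close>: all torsion points with nonzero
  ordinate have doubles with the same abscissa.\<close>

lemma torsion_double_x:
  assumes P: "on_curve (Some (p, q))" "q \<noteq> 0" and n: "n > 0" "Some (p, q) [^]\<^bsub>E_grp\<^esub> (n::nat) = None"
    and R: "pt_add (Some (p, q)) (Some (p, q)) = Some (x, y)"
  shows "4 * (x + aK * bK) = (aK + bK - cK)^2"
proof -
  have onR: "on_curve (Some (x, y))" using pt_add_add_same(2)[OF P P(1)] R by simp
  have tors: "Some (x, y) [^]\<^bsub>E_grp\<^esub> n = None" using torsion_double[OF P n(2)] R by simp
  have root: "\<exists>u. x + to_fract e = to_fract u ^ 2 \<and> degree u \<le> 3"
    if e: "degree e \<le> 6" and t: "(x + to_fract e) * (2 * q)^2 = t^2" for e t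
  proof -
    have sq: "x + to_fract e = (t / (2 * q))^2" using t P(2) by (simp add: power_divide eq_divide_eq)
    obtain u where "t / (2 * q) = to_fract u" "degree u \<le> 3"
      using torsion_root_polynomial[OF onR n(1) tors sq e] .
    then show ?thesis using sq by auto
  qed
  obtain x' y' where "pt_add (Some (p, q)) (Some (p, q)) = Some (x', y')"
    and d: "(x' + aK * bK) * (2 * q)^2 = ((p + aK * bK)^2 - (aK * bK - bK * cK) * (aK * bK - aK * cK))^2"
    "(x' + bK * cK) * (2 * q)^2 = ((p + bK * cK)^2 - (bK * cK - aK * bK) * (bK * cK - aK * cK))^2"
    "(x' + aK * cK) * (2 * q)^2 = ((p + aK * cK)^2 - (aK * cK - aK * bK) * (aK * cK - bK * cK))^2"
    using P by (rule double_coords)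
  then have "x' = x" using R by simp
  note d = d[unfolded this]
  have deg: "degree (aP * bP) \<le> 6" "degree (bP * cP) \<le> 6" "degree (aP * cP) \<le> 6"
    by (simp_all add: degree_mult_eq degree_abc)
  have ab: "aK * bK = to_fract (aP * bP)" and bc: "bK * cK = to_fract (bP * cP)"
    and ac: "aK * cK = to_fract (aP * cP)" by (simp_all add: abc_to_fract)
  obtain u1 where u1: "x + aK * bK = to_fract u1 ^ 2" "degree u1 \<le> 3"
    using root[OF deg(1), folded ab, OF d(1)] by blast
  obtain u2 where u2: "x + bK * cK = to_fract u2 ^ 2" "degree u2 \<le> 3"
    using root[OF deg(2), folded bc, OF d(2)] by blast
  obtain u3 where u3: "x + aK * cK = to_fract u3 ^ 2" "degree u3 \<le> 3"
    using root[OF deg(3), folded ac, OF d(3)] by blast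
  \<comment> \<open>Differences of the three squares eliminate \<open>x\<close>.\<close>
  have "to_fract (u1^2 - u2^2) = to_fract (bP * (aP - cP))"
    using u1(1) u2(1) by (simp add: abc_to_fract algebra_simps)
  moreover have "to_fract (u1^2 - u3^2) = to_fract (aP * (bP - cP))"
    using u1(1) u3(1) by (simp add: abc_to_fract algebra_simps)
  ultimately have "4 * u1^2 = (aP + bP - cP)^2"
    using u1 u2 u3 by (intro difference_of_squares_unique) (simp_all only: to_fract_eq_iff)
  then have "to_fract (4 * u1^2) = to_fract ((aP + bP - cP)^2)" by simp
  then show ?thesis using u1(1) by (simp add: abc_to_fract)
qed

text \<open>If \<open>q \<noteq> 0\<close>, then \<open>R = 2P\<close> is torsion and again has
  nonzero ordinate, so \<open>torsion_double_x\<close> applies to \<open>R\<close> as well and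
  yields \<open>x(2R) = x(R)\<close>. The doubling formula turns this into a false polynomial
  identity.\<close>

lemma torsion_y_eq_0:
  assumes P: "on_curve (Some (p, q))" and n: "n > 0" "Some (p, q) [^]\<^bsub>E_grp\<^esub> (n::nat) = None"
  shows "q = 0"
proof (rule ccontr)
  assume q: "q \<noteq> 0"
  note P = P q
  define S where "S = aP + bP - cP"
  define T where "T = bP + cP - aP"
  define W where "W = aP + cP - bP"
  obtain x y where R: "pt_add (Some (p, q)) (Some (p, q)) = Some (x, y)" using P by (rule double_coords)
  have onR: "on_curve (Some (x, y))" using pt_add_add_same(2)[OF P P(1)] R by simp
  have tors: "Some (x, y) [^]\<^bsub>E_grp\<^esub> n = None" using torsion_double[OF P n(2)] R by simp
  have x: "4 * (x + aK * bK) = (aK + bK - cK)^2" by (rule torsion_double_x[OF P n R])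
  then have x1: "4 * (x + aK * bK) = to_fract (S^2)" by (simp add: S_def abc_to_fract)
  have "4 * (x + bK * cK) = (bK + cK - aK)^2" using x by algebra
  then have x2: "4 * (x + bK * cK) = to_fract (T^2)" by (simp add: T_def abc_to_fract)
  have "4 * (x + aK * cK) = (aK + cK - bK)^2" using x by algebra
  then have x3: "4 * (x + aK * cK) = to_fract (W^2)" by (simp add: W_def abc_to_fract)
  have "64 * y^2 = (4 * (x + aK * bK)) * (4 * (x + bK * cK)) * (4 * (x + aK * cK))"
    using onR unfolding on_curve_def option.case prod.case by algebra
  then have y: "64 * y^2 = to_fract ((S * T * W)^2)" unfolding x1 x2 x3 by (simp add: power_mult_distrib)
  \<comment> \<open>At \<open>k = 1\<close> the values are \<open>a = 10\<close>,
    \<open>b = 17\<close>, \<open>c = -9\<close>, and \<open>S = 36\<close>, \<open>T = -2\<close>,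
    \<open>W = -16\<close>.\<close>
  have "poly (S * T * W) 1 \<noteq> 0" by (simp add: S_def T_def W_def aP_def bP_def cP_def)
  then have "S * T * W \<noteq> 0" by (metis poly_0)
  then have y0: "y \<noteq> 0" using y by auto
  obtain x' y' where RR: "pt_add (Some (x, y)) (Some (x, y)) = Some (x', y')"
    and d: "(x' + aK * bK) * (2 * y)^2 = ((x + aK * bK)^2 - (aK * bK - bK * cK) * (aK * bK - aK * cK))^2"
    using onR y0 by (rule double_coords)
  have "4 * (x' + aK * bK) = to_fract (S^2)"
    using torsion_double_x[OF onR y0 n(1) tors RR] by (simp add: S_def abc_to_fract)
  with x1 have "x' = x" by simp
  \<comment> \<open>Rescaled so that only \<open>4 * z\<close> and \<open>64 * y^2\<close> occur,
    which are known as the squares of \<open>S\<close> and \<open>S * T * W\<close>.\<close>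
  have "((4 * z)^2 - 16 * m)^2 = 4 * (4 * z) * (64 * y^2)" if "z * (2 * y)^2 = (z^2 - m)^2" for z m
    using that by algebra
  from this[OF d[unfolded \<open>x' = x\<close>]]
  have "((4 * (x + aK * bK))^2 - 16 * ((aK * bK - bK * cK) * (aK * bK - aK * cK)))^2
      = 4 * (4 * (x + aK * bK)) * (64 * y^2)" .
  then have "to_fract (((S^2)^2 - 16 * ((aP * bP - bP * cP) * (aP * bP - aP * cP)))^2)
      = to_fract (4 * S^2 * (S * T * W)^2)"
    unfolding x1 y by (simp add: abc_to_fract)
  then have "((S^2)^2 - 16 * ((aP * bP - bP * cP) * (aP * bP - aP * cP)))^2 = 4 * S^2 * (S * T * W)^2"
    by (simp only: to_fract_eq_iff)
  \<comment> \<open>At \<open>k = 1\<close> the two sides are \<open>335936^2\<close> and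
    \<open>82944^2\<close>.\<close>
  then have "poly (((S^2)^2 - 16 * ((aP * bP - bP * cP) * (aP * bP - aP * cP)))^2) 1
      = poly (4 * S^2 * (S * T * W)^2) 1" by simp
  then show False by (simp add: S_def T_def W_def aP_def bP_def cP_def)
qed

section \<open>The 2-torsion and the isomorphism\<close>

lemma roots_distinct: "aK * bK \<noteq> bK * cK" "aK * bK \<noteq> aK * cK" "bK * cK \<noteq> aK * cK"
proof -
  have "aP - cP \<noteq> 0" "bP - cP \<noteq> 0" "aP - bP \<noteq> 0" by (simp_all add: aP_def bP_def cP_def)
  then show "aK * bK \<noteq> bK * cK" "aK * bK \<noteq> aK * cK" "bK * cK \<noteq> aK * cK"
    using degree_abc by (simp_all add: abc_to_fract)
qed

lemma E_tors_eq:
  "E_tors = {None, Some (- (aK * bK), 0), Some (- (bK * cK), 0), Some (- (aK * cK), 0)}" (is "_ = ?T")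
proof
  show "E_tors \<subseteq> ?T"
  proof
    fix P assume "P \<in> E_tors"
    then obtain n :: nat where P: "on_curve P" "n > 0" "P [^]\<^bsub>E_grp\<^esub> n = None"
      by (auto simp: E_tors_def)
    show "P \<in> ?T"
    proof (cases P)
      case (Some a)
      then obtain p q where pq: "P = Some (p, q)" by (cases a) auto
      then have "q = 0" using torsion_y_eq_0 P by blast
      then have "(p + aK * bK) * (p + bK * cK) * (p + aK * cK) = 0"
        using P(1) pq by (simp add: on_curve_def)
      then show ?thesis using \<open>q = 0\<close> pq by (auto simp: add_eq_0_iff2)
    qed simp
  qed
  show "?T \<subseteq> E_tors"
  proof
    fix P assume "P \<in> ?T"
    then have "on_curve P" "P [^]\<^bsub>E_grp\<^esub> (2::nat) = None"
      by (auto simp: on_curve_def numeral_2_eq_2 pt_add_def)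
    then show "P \<in> E_tors" unfolding E_tors_def by (intro CollectI conjI exI[of _ 2]) simp_all
  qed
qed

text \<open>The chord is the x-axis, which meets the curve in the three roots of the cubic.\<close>

lemma pt_add_two_torsion:
  assumes "e \<noteq> f" "A2 = e + f + g"
  shows "pt_add (Some (- e, 0)) (Some (- f, 0)) = Some (- g, 0)"
  using pt_add_chord[of "- e" "- f" 0 0 0 "- g"] assms by simp

theorem theorem4p1:
  shows "E_grp\<lparr>carrier := E_tors\<rparr> \<cong> DirProd (integer_mod_group 2) (integer_mod_group 2)"
proof -
  let ?T1 = "Some (- (aK * bK), 0)" and ?T2 = "Some (- (bK * cK), 0)" and ?T3 = "Some (- (aK * cK), 0)"
  \<comment> \<open>\<open>?T1\<close> and \<open>?T2\<close> serve as generators and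
    \<open>?T3\<close> is their sum; the last value is also an arbitrary default outside
    \<open>E_tors\<close>.\<close>
  define h :: "pt \<Rightarrow> int \<times> int" where
    "h P = (if P = None then (0, 0) else if P = ?T1 then (1, 0) else if P = ?T2 then (0, 1) else (1, 1))" for P
  note d = roots_distinct roots_distinct[symmetric]
  have sums: "pt_add ?T1 ?T2 = ?T3" "pt_add ?T2 ?T1 = ?T3" "pt_add ?T1 ?T3 = ?T2"
    "pt_add ?T3 ?T1 = ?T2" "pt_add ?T2 ?T3 = ?T1" "pt_add ?T3 ?T2 = ?T1"
    by (intro pt_add_two_torsion; use d in \<open>auto simp: A2_def\<close>)+
  have dbl: "pt_add (Some (e, 0)) (Some (e, 0)) = None" for e by (simp add: pt_add_def)
  have h: "h None = (0, 0)" "h ?T1 = (1, 0)" "h ?T2 = (0, 1)" "h ?T3 = (1, 1)"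
    using d by (auto simp: h_def)
  have carr: "carrier (DirProd (integer_mod_group 2) (integer_mod_group 2)) = {0, 1} \<times> {0, 1}"
    by (auto simp: DirProd_def carrier_integer_mod_group)
  have "h \<in> hom (E_grp\<lparr>carrier := E_tors\<rparr>) (DirProd (integer_mod_group 2) (integer_mod_group 2))"
    unfolding hom_def carr
    by (auto simp: E_tors_eq h sums dbl DirProd_def)
  moreover have "bij_betw h E_tors ({0, 1} \<times> {0, 1})"
    unfolding bij_betw_def E_tors_eq using d by (auto simp: inj_on_def h)
  ultimately have "h \<in> iso (E_grp\<lparr>carrier := E_tors\<rparr>) (DirProd (integer_mod_group 2) (integer_mod_group 2))"
    unfolding iso_def carr by simp
  then show ?thesis by (auto simp: is_iso_def)
qed

end
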